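(* There is an algorithm which, given an $n$-point metric space $(X,\rho)$, runs in time $O(n^2)$ and outputs a set $\mathcal{O}\subseteq X$ such that $(X\setminus\mathcal{O},\rho)$ is a tree metric and $|\mathcal{O}|\le 4\,|\mathcal{O}^*|$, where $\mathcal{O}^*$ is a minimum-cardinality subset of $X$ for which $(X\setminus\mathcal{O}^*,\rho)$ is a tree metric. That is, there is a $4$-approximation algorithm for minimum outlier embedding into trees with running time $O(n^2)$.
   Context: A metric space $(X,\rho)$ is a tree metric if for all $x,y,z,w\in X$, $\rho(x,y)+\rho(z,w)\le\max\{\rho(x,z)+\rho(y,w),\rho(x,w)+\rho(y,z)\}$ (four-point condition); equivalently it embeds isometrically into the shortest-path metric of an edge-weighted tree. The minimum outlier embedding problem into trees asks, given a finite metric space (given by its distance matrix), for a minimum-size set $\mathcal{O}\subseteq X$ such that $(X\setminus\mathcal{O},\rho)$ is a tree metric. *)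

theory Defs
  imports "HOL-Analysis.Abstract_Metric_Spaces" "HOL-Library.Landau_Symbols"
begin

section \<open>Tree metrics and outlier sets\<close>

definition tree_metric :: "'a set \<Rightarrow> ('a \<Rightarrow> 'a \<Rightarrow> real) \<Rightarrow> bool" where
  "tree_metric X \<rho> \<longleftrightarrow> Metric_space X \<rho> \<and>
     (\<forall>x\<in>X. \<forall>y\<in>X. \<forall>z\<in>X. \<forall>w\<in>X.
        \<rho> x y + \<rho> z w \<le> max (\<rho> x z + \<rho> y w) (\<rho> x w + \<rho> y z))"

definition outlier_set :: "'a set \<Rightarrow> ('a \<Rightarrow> 'a \<Rightarrow> real) \<Rightarrow> 'a set \<Rightarrow> bool" where
  "outlier_set X \<rho> Q \<longleftrightarrow> Q \<subseteq> X \<and> tree_metric (X - Q) \<rho>"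

definition min_outlier_set :: "'a set \<Rightarrow> ('a \<Rightarrow> 'a \<Rightarrow> real) \<Rightarrow> 'a set \<Rightarrow> bool" where
  "min_outlier_set X \<rho> Q \<longleftrightarrow> is_arg_min card (outlier_set X \<rho>) Q"

text \<open>A minimum always exists (for infinite \<open>Q\<close> one has \<open>card Q = 0\<close>, but the notion is only
  used for finite \<open>X\<close>, where every outlier set is finite).\<close>

lemma ex_min_outlier_set: "\<exists>Q. min_outlier_set X \<rho> Q" if "Metric_space X \<rho>"
proof -
  have "Metric_space {} \<rho>"
    using that by (simp add: Metric_space_def)
  then have "outlier_set X \<rho> X"
    by (simp add: outlier_set_def tree_metric_def)
  then show ?thesis
    unfolding min_outlier_set_def is_arg_min_linorder
    using ex_has_least_nat[of "outlier_set X \<rho>" X card] by blast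
qed


section \<open>A real random access machine\<close>

text \<open>Algorithms are programs of a real RAM, presented as a while language over two separate
  memories, one for natural numbers and one for real numbers. Both are divided into named
  arrays with computed indices; a scalar variable is the cell with index \<open>0\<close> of its array.
  Every operation has unit cost. Two restrictions keep the unit-cost measure meaningful:
  there is no multiplication on natural numbers, and a real number can influence the natural
  number memory only through comparisons (there is no rounding). Real constants are only
  available as images of natural numbers, so no information can be hidden in them.\<close>

type_synonym vname = string

datatype nexp =
    N nat
  | NCell vname nexp
  | NPlus nexp nexp
  | NMinus nexp nexp

datatype rexp =
    OfNat nexp
  | RCell vname nexp
  | Dist nexp nexp  \<comment> \<open>entry of the input matrix\<close>
  | RPlus rexp rexp
  | RMinus rexp rexp
  | RTimes rexp rexp
  | RDivide rexp rexp

datatype bexp =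
    NLess nexp nexp
  | NEq nexp nexp
  | RLess rexp rexp
  | REq rexp rexp
  | BNot bexp
  | BAnd bexp bexp

datatype com =
    Skip
  | NAssign vname nexp nexp  \<comment> \<open>\<open>NAssign x i e\<close> writes the value of \<open>e\<close> to \<open>x[i]\<close>\<close>
  | RAssign vname nexp rexp
  | Seq com com
  | Cond bexp com com
  | While bexp com

record state =
  nmem :: "vname \<Rightarrow> nat \<Rightarrow> nat"
  rmem :: "vname \<Rightarrow> nat \<Rightarrow> real"

primrec nval :: "nexp \<Rightarrow> state \<Rightarrow> nat" where
  "nval (N k) s = k"
| "nval (NCell x i) s = nmem s x (nval i s)"
| "nval (NPlus a b) s = nval a s + nval b s"
| "nval (NMinus a b) s = nval a s - nval b s"

text \<open>The input is an \<open>n \<times> n\<close> matrix \<open>D\<close>. It is read-only, and entries outside the range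
  read as \<open>0\<close>, so that values of the function \<open>D\<close> beyond the matrix are not accessible.\<close>

primrec rval :: "nat \<Rightarrow> (nat \<Rightarrow> nat \<Rightarrow> real) \<Rightarrow> rexp \<Rightarrow> state \<Rightarrow> real" where
  "rval n D (OfNat a) s = real (nval a s)"
| "rval n D (RCell x i) s = rmem s x (nval i s)"
| "rval n D (Dist i j) s = (if nval i s < n \<and> nval j s < n then D (nval i s) (nval j s) else 0)"
| "rval n D (RPlus a b) s = rval n D a s + rval n D b s"
| "rval n D (RMinus a b) s = rval n D a s - rval n D b s"
| "rval n D (RTimes a b) s = rval n D a s * rval n D b s"
| "rval n D (RDivide a b) s = rval n D a s / rval n D b s"

primrec bval :: "nat \<Rightarrow> (nat \<Rightarrow> nat \<Rightarrow> real) \<Rightarrow> bexp \<Rightarrow> state \<Rightarrow> bool" where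
  "bval n D (NLess a b) s \<longleftrightarrow> nval a s < nval b s"
| "bval n D (NEq a b) s \<longleftrightarrow> nval a s = nval b s"
| "bval n D (RLess a b) s \<longleftrightarrow> rval n D a s < rval n D b s"
| "bval n D (REq a b) s \<longleftrightarrow> rval n D a s = rval n D b s"
| "bval n D (BNot b) s \<longleftrightarrow> \<not> bval n D b s"
| "bval n D (BAnd b c) s \<longleftrightarrow> bval n D b s \<and> bval n D c s"

text \<open>The cost of evaluating an expression is its number of nodes.\<close>

primrec ncost :: "nexp \<Rightarrow> nat" where
  "ncost (N k) = 1"
| "ncost (NCell x i) = 1 + ncost i"
| "ncost (NPlus a b) = 1 + ncost a + ncost b"
| "ncost (NMinus a b) = 1 + ncost a + ncost b"

primrec rcost :: "rexp \<Rightarrow> nat" where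
  "rcost (OfNat a) = 1 + ncost a"
| "rcost (RCell x i) = 1 + ncost i"
| "rcost (Dist i j) = 1 + ncost i + ncost j"
| "rcost (RPlus a b) = 1 + rcost a + rcost b"
| "rcost (RMinus a b) = 1 + rcost a + rcost b"
| "rcost (RTimes a b) = 1 + rcost a + rcost b"
| "rcost (RDivide a b) = 1 + rcost a + rcost b"

primrec bcost :: "bexp \<Rightarrow> nat" where
  "bcost (NLess a b) = 1 + ncost a + ncost b"
| "bcost (NEq a b) = 1 + ncost a + ncost b"
| "bcost (RLess a b) = 1 + rcost a + rcost b"
| "bcost (REq a b) = 1 + rcost a + rcost b"
| "bcost (BNot b) = 1 + bcost b"
| "bcost (BAnd b c) = 1 + bcost b + bcost c"

definition nwrite :: "vname \<Rightarrow> nat \<Rightarrow> nat \<Rightarrow> state \<Rightarrow> state" where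
  "nwrite x i v s = s\<lparr>nmem := (nmem s)(x := (nmem s x)(i := v))\<rparr>"

definition rwrite :: "vname \<Rightarrow> nat \<Rightarrow> real \<Rightarrow> state \<Rightarrow> state" where
  "rwrite x i v s = s\<lparr>rmem := (rmem s)(x := (rmem s x)(i := v))\<rparr>"

text \<open>\<open>exec n D c s t s'\<close>: on input matrix \<open>D\<close>, started in state \<open>s\<close>, the program \<open>c\<close> terminates
  in state \<open>s'\<close> after exactly \<open>t\<close> time units.\<close>

inductive exec :: "nat \<Rightarrow> (nat \<Rightarrow> nat \<Rightarrow> real) \<Rightarrow> com \<Rightarrow> state \<Rightarrow> nat \<Rightarrow> state \<Rightarrow> bool"
  for n :: nat and D :: "nat \<Rightarrow> nat \<Rightarrow> real" where
  exec_Skip: "exec n D Skip s 1 s"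
| exec_NAssign: "exec n D (NAssign x i e) s (1 + ncost i + ncost e) (nwrite x (nval i s) (nval e s) s)"
| exec_RAssign: "exec n D (RAssign x i e) s (1 + ncost i + rcost e) (rwrite x (nval i s) (rval n D e s) s)"
| exec_Seq: "exec n D c1 s t1 s' \<Longrightarrow> exec n D c2 s' t2 s'' \<Longrightarrow> exec n D (Seq c1 c2) s (t1 + t2) s''"
| exec_CondTrue: "bval n D b s \<Longrightarrow> exec n D c1 s t s' \<Longrightarrow> exec n D (Cond b c1 c2) s (1 + bcost b + t) s'"
| exec_CondFalse: "\<not> bval n D b s \<Longrightarrow> exec n D c2 s t s' \<Longrightarrow> exec n D (Cond b c1 c2) s (1 + bcost b + t) s'"
| exec_WhileFalse: "\<not> bval n D b s \<Longrightarrow> exec n D (While b c) s (1 + bcost b) s"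
| exec_WhileTrue: "bval n D b s \<Longrightarrow> exec n D c s t1 s' \<Longrightarrow> exec n D (While b c) s' t2 s'' \<Longrightarrow>
    exec n D (While b c) s (1 + bcost b + t1 + t2) s''"

inductive_cases exec_SkipE: "exec n D Skip s t s'"
inductive_cases exec_NAssignE: "exec n D (NAssign x i e) s t s'"
inductive_cases exec_RAssignE: "exec n D (RAssign x i e) s t s'"
inductive_cases exec_SeqE: "exec n D (Seq c1 c2) s t s'"
inductive_cases exec_CondE: "exec n D (Cond b c1 c2) s t s'"
inductive_cases exec_WhileE: "exec n D (While b c) s t s'"

text \<open>Programs are deterministic, so the existence of a terminating execution with some property
  says that the run of the program has this property.\<close>

lemma exec_deterministic:
  "exec n D c s t s' \<Longrightarrow> exec n D c s u s'' \<Longrightarrow> u = t \<and> s'' = s'"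
proof (induction arbitrary: u s'' rule: exec.induct)
  case (exec_Skip s)
  then show ?case by (rule exec_SkipE) simp
next
  case (exec_NAssign x i e s)
  then show ?case by (rule exec_NAssignE) simp
next
  case (exec_RAssign x i e s)
  then show ?case by (rule exec_RAssignE) simp
next
  case (exec_Seq c1 s t1 s' c2 t2 s3)
  from exec_Seq.prems obtain u1 r u2 where
    "exec n D c1 s u1 r" "exec n D c2 r u2 s''" "u = u1 + u2"
    by (rule exec_SeqE)
  then show ?case using exec_Seq.IH by metis
next
  case (exec_CondTrue b s c1 t s' c2)
  from exec_CondTrue.prems obtain u' where "exec n D c1 s u' s''" "u = 1 + bcost b + u'"
    by (rule exec_CondE) (use exec_CondTrue.hyps in simp_all)
  then show ?case using exec_CondTrue.IH by metis
next
  case (exec_CondFalse b s c2 t s' c1)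
  from exec_CondFalse.prems obtain u' where "exec n D c2 s u' s''" "u = 1 + bcost b + u'"
    by (rule exec_CondE) (use exec_CondFalse.hyps in simp_all)
  then show ?case using exec_CondFalse.IH by metis
next
  case (exec_WhileFalse b s c)
  from exec_WhileFalse.prems show ?case
    by (rule exec_WhileE) (use exec_WhileFalse.hyps in simp_all)
next
  case (exec_WhileTrue b s c t1 s' t2 s3)
  from exec_WhileTrue.prems obtain u1 r u2 where
    "exec n D c s u1 r" "exec n D (While b c) r u2 s''" "u = 1 + bcost b + u1 + u2"
    by (rule exec_WhileE) (use exec_WhileTrue.hyps in simp_all)
  then show ?case using exec_WhileTrue.IH by metis
qed

text \<open>Initially the memory is zero, except that the scalar \<open>n\<close> holds the number of points.
  The output is a subset of \<open>{..<n}\<close>, given by its indicator array \<open>out\<close>.\<close>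

definition init_state :: "nat \<Rightarrow> state" where
  "init_state n = \<lparr>nmem = (\<lambda>_ _. 0)(''n'' := (\<lambda>_. 0)(0 := n)), rmem = (\<lambda>_ _. 0)\<rparr>"

definition outcome :: "nat \<Rightarrow> state \<Rightarrow> nat set" where
  "outcome n s = {i. i < n \<and> nmem s ''out'' i \<noteq> 0}"

end

theory Submission
  imports Defs
begin

text \<open>The points are inserted one by one into a set \<open>S\<close> on which \<open>\<rho>\<close> is a tree metric. For a new
  point \<open>x\<close>, fix any \<open>r \<in> S\<close> and let \<open>y \<in> S\<close> minimise \<open>\<rho> x y - \<rho> r y\<close>, that is, maximise the Gromov
  product of \<open>x\<close> and \<open>y\<close> at \<open>r\<close>. If the four-point condition holds on \<open>{x, r, y, z}\<close> for all
  \<open>z \<in> S\<close>, then \<open>\<rho> x z = max (\<rho> r z + a) (\<rho> y z + b)\<close> for constants \<open>a\<close> and \<open>b\<close>, and since the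
  four-point inequality is preserved by such maxima, \<open>S \<union> {x}\<close> is a tree metric. Otherwise some
  \<open>{x, r, y, z}\<close> is not a tree metric, and all its points become outliers. These quadruples are
  disjoint and each of them meets every outlier set, which gives the factor \<open>4\<close>. An insertion takes
  linear time and requires no data structure besides \<open>S\<close>.\<close>

section \<open>Inserting a point into a tree metric\<close>

text \<open>Of the three pair sums on \<open>{x, r, y, z}\<close>, the one pairing \<open>x\<close>
  with \<open>z\<close> is largest and tied with another. This is the four-point condition in a form
  that can be solved for \<open>\<rho> x z\<close>.\<close>

definition attaches :: "('a \<Rightarrow> 'a \<Rightarrow> real) \<Rightarrow> 'a \<Rightarrow> 'a \<Rightarrow> 'a \<Rightarrow> 'a \<Rightarrow> bool" where
  "attaches \<rho> x r y z \<longleftrightarrow> \<rho> x z + \<rho> r y = max (\<rho> r z + \<rho> x y) (\<rho> x r + \<rho> y z)"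

lemma tree_metric_mono: "tree_metric X \<rho> \<Longrightarrow> Y \<subseteq> X \<Longrightarrow> tree_metric Y \<rho>"
  unfolding tree_metric_def by (meson Metric_space.subspace subsetD)

text \<open>In a tree metric the two largest pair sums coincide. The last assumption, which the
  minimality of \<open>y\<close> supplies, rules out that the sum pairing \<open>x\<close> with
  \<open>z\<close> is the strictly smallest.\<close>

lemma tree_metric_attaches:
  assumes "tree_metric X \<rho>" "{x, r, y, z} \<subseteq> X" "\<rho> x y + \<rho> r z \<le> \<rho> x z + \<rho> r y"
  shows "attaches \<rho> x r y z"
proof -
  interpret Metric_space X \<rho>
    using assms(1) by (simp add: tree_metric_def)
  have four: "\<rho> a b + \<rho> c d \<le> max (\<rho> a c + \<rho> b d) (\<rho> a d + \<rho> b c)"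
    if "a \<in> X" "b \<in> X" "c \<in> X" "d \<in> X" for a b c d
    using assms(1) that by (simp add: tree_metric_def)
  show ?thesis
    using four[of x z r y] four[of x r y z] assms(2,3) commute[of z r] commute[of z y]
    unfolding attaches_def by auto
qed

lemma tree_metric_insert:
  assumes "Metric_space (insert x S) \<rho>" and S: "tree_metric S \<rho>" and ry: "r \<in> S" "y \<in> S"
    and att: "\<And>z. z \<in> S \<Longrightarrow> attaches \<rho> x r y z"
  shows "tree_metric (insert x S) \<rho>"
proof -
  interpret Metric_space "insert x S" \<rho> by fact
  have four: "\<rho> a b + \<rho> c d \<le> max (\<rho> a c + \<rho> b d) (\<rho> a d + \<rho> b c)"
    if "a \<in> S" "b \<in> S" "c \<in> S" "d \<in> S" for a b c d
    using S that by (simp add: tree_metric_def)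
  have max_eq: "\<rho> x z = max (\<rho> r z + (\<rho> x y - \<rho> r y)) (\<rho> y z + (\<rho> x r - \<rho> r y))" if "z \<in> S" for z
    using att[OF that] unfolding attaches_def by linarith
  \<comment> \<open>Whichever of \<open>r\<close> and \<open>y\<close> attains the maximum for
    \<open>\<rho> x a\<close>, apply the four-point inequality of \<open>S\<close> to it and
    \<open>a\<close>, \<open>b\<close>, \<open>c\<close>, and add its constant. The right-hand side
    is then dominated by the maxima for \<open>\<rho> x b\<close> and
    \<open>\<rho> x c\<close>.\<close>
  have four_x: "\<rho> x a + \<rho> b c \<le> max (\<rho> x b + \<rho> a c) (\<rho> x c + \<rho> a b)"
    if "a \<in> S" "b \<in> S" "c \<in> S" for a b c
    using max_eq[of a] max_eq[of b] max_eq[of c] four[of r a b c] four[of y a b c] that ry by linarith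
  have "\<rho> a b + \<rho> c d \<le> max (\<rho> a c + \<rho> b d) (\<rho> a d + \<rho> b c)"
    if abcd: "a \<in> insert x S" "b \<in> insert x S" "c \<in> insert x S" "d \<in> insert x S" for a b c d
  proof -
    consider (same) "a = b \<or> a = c \<or> a = d \<or> b = c \<or> b = d \<or> c = d"
      | (in_S) "a \<in> S" "b \<in> S" "c \<in> S" "d \<in> S"
      | (a) "a = x" "b \<in> S" "c \<in> S" "d \<in> S" | (b) "b = x" "a \<in> S" "c \<in> S" "d \<in> S"
      | (c) "c = x" "a \<in> S" "b \<in> S" "d \<in> S" | (d) "d = x" "a \<in> S" "b \<in> S" "c \<in> S"
      using abcd by blast
    then show ?thesis
    proof cases
      \<comment> \<open>Coincident points leave a triangle inequality (\<open>a = b\<close> or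
        \<open>c = d\<close>) or a term that already occurs on the right. In the remaining cases
        \<open>x\<close> occurs at most once.\<close>
      case same
      then show ?thesis
        using triangle[of a c b] triangle[of c a d] abcd commute by (auto simp: max_def)
    next
      case in_S
      then show ?thesis by (rule four)
    next
      case a
      then show ?thesis using four_x[of b c d] by simp
    next
      case b
      then show ?thesis using four_x[of a c d] commute by (simp add: max.commute)
    next
      case c
      then show ?thesis using four_x[of d a b] commute by (simp add: algebra_simps)
    next
      case d
      then show ?thesis using four_x[of c a b] commute by (simp add: algebra_simps max.commute)
    qed
  qed
  then show ?thesis
    using Metric_space_axioms by (simp add: tree_metric_def)
qed

section \<open>Partial solutions and the charging argument for the factor 4\<close>

text \<open>Counting \<open>Q \<inter> R\<close> instead of \<open>Q\<close> makes the bound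
  additive over disjoint quadruples, so it survives each removal.\<close>

definition partial_outliers :: "nat \<Rightarrow> (nat \<Rightarrow> nat \<Rightarrow> real) \<Rightarrow> nat \<Rightarrow> nat set \<Rightarrow> bool" where
  "partial_outliers n \<rho> k R \<longleftrightarrow> R \<subseteq> {..<k} \<and> tree_metric ({..<k} - R) \<rho> \<and>
     (\<forall>Q. outlier_set {..<n} \<rho> Q \<longrightarrow> card R \<le> 4 * card (Q \<inter> R))"

lemma partial_outliers_0: "Metric_space {..<n} \<rho> \<Longrightarrow> partial_outliers n \<rho> 0 {}"
  using Metric_space.subspace[of "{..<n}" \<rho> "{}"] by (simp add: partial_outliers_def tree_metric_def)

lemma partial_outliers_keep:
  assumes M: "Metric_space {..<n} \<rho>" and k: "k < n" and R: "partial_outliers n \<rho> k R"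
    and S: "S = {..<k} - R"
    and att: "S \<noteq> {} \<Longrightarrow> r \<in> S \<and> y \<in> S \<and> (\<forall>z\<in>S. attaches \<rho> k r y z)"
  shows "partial_outliers n \<rho> (Suc k) R"
proof -
  have eq: "{..<Suc k} - R = insert k S"
    using R S unfolding partial_outliers_def by auto
  have "insert k S \<subseteq> {..<n}"
    using k S by auto
  then have M': "Metric_space (insert k S) \<rho>"
    using Metric_space.subspace[OF M] by blast
  have "tree_metric (insert k S) \<rho>"
  proof (cases "S = {}")
    case True
    then show ?thesis using M' by (simp add: tree_metric_def)
  next
    case False
    then show ?thesis
      using tree_metric_insert[OF M', of r y] att R S unfolding partial_outliers_def by blast
  qed
  then show ?thesis
    using R eq unfolding partial_outliers_def by (simp add: lessThan_Suc subset_insertI2)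
qed

text \<open>The new quadruple is disjoint from \<open>R\<close>, as \<open>k\<close> is new and the
  other points were kept. It adds at most 4 to the left side of the bound and, since
  \<open>Q\<close> must meet it, at least 4 to the right side.\<close>

lemma partial_outliers_remove:
  assumes k: "k < n" and R: "partial_outliers n \<rho> k R" and S: "S = {..<k} - R"
    and in_S: "r \<in> S" "y \<in> S" "z \<in> S"
    and y_min: "\<rho> k y + \<rho> r z \<le> \<rho> k z + \<rho> r y" and not_att: "\<not> attaches \<rho> k r y z"
  shows "partial_outliers n \<rho> (Suc k) (R \<union> {k, r, y, z})"
proof -
  let ?F = "{k, r, y, z}"
  have fin: "finite R" and disj: "R \<inter> ?F = {}"
    using R S in_S finite_subset[of R "{..<k}"] unfolding partial_outliers_def by auto
  have "card (R \<union> ?F) \<le> 4 * card (Q \<inter> (R \<union> ?F))" if Q: "outlier_set {..<n} \<rho> Q" for Q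
  proof -
    \<comment> \<open>If \<open>Q\<close> avoided the quadruple, the tree metric outside
      \<open>Q\<close> would force \<open>attaches\<close>.\<close>
    have "\<not> ?F \<subseteq> {..<n} - Q"
      using tree_metric_attaches[OF _ _ y_min] not_att Q unfolding outlier_set_def by blast
    then have "Q \<inter> ?F \<noteq> {}"
      using in_S k S by auto
    then have "1 \<le> card (Q \<inter> ?F)"
      by (metis One_nat_def Suc_leI card_gt_0_iff finite.emptyI finite_Int finite_insert)
    moreover have "card ?F \<le> 4"
      using card_length[of "[k, r, y, z]"] by simp
    moreover have "card (R \<union> ?F) = card R + card ?F"
      using fin disj by (intro card_Un_disjoint) auto
    moreover have "card (Q \<inter> (R \<union> ?F)) = card (Q \<inter> R) + card (Q \<inter> ?F)"
      unfolding Int_Un_distrib using fin disj by (intro card_Un_disjoint) auto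
    moreover have "card R \<le> 4 * card (Q \<inter> R)"
      using R Q unfolding partial_outliers_def by blast
    ultimately show ?thesis by linarith
  qed
  moreover have "tree_metric ({..<Suc k} - (R \<union> ?F)) \<rho>"
    using R unfolding partial_outliers_def
    by (auto intro: tree_metric_mono[of "{..<k} - R"] simp: less_Suc_eq)
  moreover have "R \<union> ?F \<subseteq> {..<Suc k}"
    using R S in_S unfolding partial_outliers_def by auto
  ultimately show ?thesis
    unfolding partial_outliers_def by blast
qed

lemma partial_outliers_outlier_set: "partial_outliers n \<rho> n R \<Longrightarrow> outlier_set {..<n} \<rho> R"
  unfolding partial_outliers_def outlier_set_def by blast

lemma partial_outliers_card_le:
  assumes R: "partial_outliers n \<rho> n R" and Q: "outlier_set {..<n} \<rho> Q"
  shows "card R \<le> 4 * card Q"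
proof -
  have "finite Q"
    using Q finite_subset[of Q "{..<n}"] unfolding outlier_set_def by blast
  then have "card (Q \<inter> R) \<le> card Q"
    by (intro card_mono) auto
  then show ?thesis
    using R Q unfolding partial_outliers_def by (meson le_trans mult_le_mono2)
qed


section \<open>Total correctness with time bounds\<close>

text \<open>Time is only bounded above, so that branches of different cost can share one
  \<open>B\<close>. By determinism, the existential run is the run.\<close>

definition runs :: "nat \<Rightarrow> (nat \<Rightarrow> nat \<Rightarrow> real) \<Rightarrow> com \<Rightarrow> state \<Rightarrow> nat \<Rightarrow> (state \<Rightarrow> bool) \<Rightarrow> bool" where
  "runs n D c s B Q \<longleftrightarrow> (\<exists>t s'. exec n D c s t s' \<and> t \<le> B \<and> Q s')"

lemma runs_weaken:
  assumes "runs n D c s B Q" "B \<le> B'" "\<And>s'. Q s' \<Longrightarrow> Q' s'"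
  shows "runs n D c s B' Q'"
  using assms unfolding runs_def by (meson le_trans)

lemma runs_Skip: "Q s \<Longrightarrow> 1 \<le> B \<Longrightarrow> runs n D Skip s B Q"
  unfolding runs_def by (meson exec_Skip)

lemma runs_NAssign:
  "Q (nwrite x (nval i s) (nval e s) s) \<Longrightarrow> 1 + ncost i + ncost e \<le> B \<Longrightarrow>
    runs n D (NAssign x i e) s B Q"
  unfolding runs_def by (meson exec_NAssign)

lemma runs_Seq:
  assumes "runs n D c1 s B1 Q1" "\<And>s'. Q1 s' \<Longrightarrow> runs n D c2 s' B2 Q"
  shows "runs n D (Seq c1 c2) s (B1 + B2) Q"
proof -
  obtain t1 s1 where 1: "exec n D c1 s t1 s1" "t1 \<le> B1" "Q1 s1"
    using assms(1) unfolding runs_def by blast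
  moreover obtain t2 s2 where "exec n D c2 s1 t2 s2" "t2 \<le> B2" "Q s2"
    using assms(2)[OF 1(3)] unfolding runs_def by blast
  ultimately show ?thesis
    unfolding runs_def by (meson exec_Seq add_mono)
qed

lemma runs_Seq_NAssign:
  assumes "runs n D c (nwrite x (nval i s) (nval e s) s) B Q"
  shows "runs n D (Seq (NAssign x i e) c) s (1 + ncost i + ncost e + B) Q"
  by (rule runs_Seq[OF runs_NAssign[where Q = "\<lambda>s'. s' = nwrite x (nval i s) (nval e s) s"]])
    (use assms in auto)

lemma runs_Cond:
  assumes "bval n D b s \<Longrightarrow> runs n D c1 s B Q" "\<not> bval n D b s \<Longrightarrow> runs n D c2 s B Q"
  shows "runs n D (Cond b c1 c2) s (1 + bcost b + B) Q"
proof (cases "bval n D b s")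
  case True
  then show ?thesis
    using assms(1) unfolding runs_def by (meson exec_CondTrue add_left_mono)
next
  case False
  then show ?thesis
    using assms(2) unfolding runs_def by (meson exec_CondFalse add_left_mono)
qed

abbreviation "scalar x \<equiv> NCell x (N 0)"

definition For :: "vname \<Rightarrow> nexp \<Rightarrow> com \<Rightarrow> com" where
  "For x e c = Seq (NAssign x (N 0) (N 0))
     (While (NLess (scalar x) e) (Seq c (NAssign x (N 0) (NPlus (scalar x) (N 1)))))"

text \<open>The invariant speaks of the state after the counter update. Initialisation costs 3, each
  test \<open>4 + ncost e\<close> and each increment 6; the final failing test is included.\<close>

lemma runs_For:
  assumes init: "I 0 (nwrite x 0 0 s)"
    and body: "\<And>j s. j < m \<Longrightarrow> I j s \<Longrightarrow> nmem s x 0 = j \<Longrightarrow>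
      runs n D c s B (\<lambda>s'. nmem s' x 0 = j \<and> I (Suc j) (nwrite x 0 (Suc j) s'))"
    and bound: "\<And>j s. I j s \<Longrightarrow> nval e s = m"
  shows "runs n D (For x e c) s (7 + ncost e + m * (10 + ncost e + B)) (I m)"
proof -
  let ?inc = "NAssign x (N 0) (NPlus (scalar x) (N 1))"
  let ?w = "While (NLess (scalar x) e) (Seq c ?inc)"
  \<comment> \<open>Induction on the number \<open>l\<close> of remaining iterations.\<close>
  have "runs n D ?w s (4 + ncost e + l * (10 + ncost e + B)) (I m)"
    if "I j s" "nmem s x 0 = j" "j + l = m" for j l s
    using that
  proof (induction l arbitrary: j s)
    case 0
    then have "exec n D ?w s (1 + bcost (NLess (scalar x) e)) s"
      using bound[of j s] by (intro exec_WhileFalse) simp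
    then show ?case
      unfolding runs_def using 0 by (intro exI[of _ s] exI) auto
  next
    case (Suc l)
    have "runs n D (Seq c ?inc) s (B + 6) (\<lambda>s'. nmem s' x 0 = Suc j \<and> I (Suc j) s')"
      by (rule runs_Seq[OF body[of j s]]) (use Suc.prems in \<open>auto intro!: runs_NAssign simp: nwrite_def\<close>)
    then obtain t1 s1 where 1: "exec n D (Seq c ?inc) s t1 s1" "t1 \<le> B + 6"
      "nmem s1 x 0 = Suc j" "I (Suc j) s1"
      unfolding runs_def by blast
    obtain t2 s2 where 2: "exec n D ?w s1 t2 s2" "t2 \<le> 4 + ncost e + l * (10 + ncost e + B)" "I m s2"
      using Suc.IH[OF 1(4,3)] Suc.prems unfolding runs_def by auto
    have "bval n D (NLess (scalar x) e) s"
      using Suc.prems bound[of j s] by simp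
    from exec_WhileTrue[OF this 1(1) 2(1)] show ?case
      unfolding runs_def using 1(2) 2(2,3) by (intro exI conjI) auto
  qed
  from this[of 0 "nwrite x 0 0 s" m]
  have "runs n D ?w (nwrite x 0 0 s) (4 + ncost e + m * (10 + ncost e + B)) (I m)"
    using init by (simp add: nwrite_def)
  then have "runs n D (For x e c) s (3 + (4 + ncost e + m * (10 + ncost e + B))) (I m)"
    unfolding For_def using runs_Seq_NAssign[where i = "N 0" and e = "N 0"] by fastforce
  then show ?thesis
    by (rule runs_weaken) auto
qed


section \<open>The program\<close>

text \<open>One template for all three linear passes. The last hit wins, and without a hit
  \<open>x\<close> keeps the default \<open>e\<close>. As \<open>b\<close> may read
  \<open>x\<close>, the template also computes a running minimum.\<close>

definition scan :: "vname \<Rightarrow> nexp \<Rightarrow> bexp \<Rightarrow> com" where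
  "scan x e b = Seq (NAssign x (N 0) e)
     (For ''i'' (scalar ''k'') (Cond b (NAssign x (N 0) (scalar ''i'')) Skip))"

lemma runs_scan:
  assumes x: "x \<noteq> ''i''" and k: "k \<le> n"
    and init: "I 0 (nwrite ''i'' 0 0 (nwrite x 0 (nval e s) s))"
    and hit: "\<And>j s. j < k \<Longrightarrow> I j s \<Longrightarrow> nmem s ''i'' 0 = j \<Longrightarrow> bval n D b s \<Longrightarrow>
      I (Suc j) (nwrite ''i'' 0 (Suc j) (nwrite x 0 j s))"
    and miss: "\<And>j s. j < k \<Longrightarrow> I j s \<Longrightarrow> nmem s ''i'' 0 = j \<Longrightarrow> \<not> bval n D b s \<Longrightarrow>
      I (Suc j) (nwrite ''i'' 0 (Suc j) s)"
    and bound: "\<And>j s. I j s \<Longrightarrow> nmem s ''k'' 0 = k"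
  shows "runs n D (scan x e b) s (11 + ncost e + n * (17 + bcost b)) (I k)"
proof -
  let ?c = "Cond b (NAssign x (N 0) (scalar ''i'')) Skip"
  have "runs n D ?c s (1 + bcost b + 4)
      (\<lambda>s'. nmem s' ''i'' 0 = j \<and> I (Suc j) (nwrite ''i'' 0 (Suc j) s'))"
    if "j < k" "I j s" "nmem s ''i'' 0 = j" for j s
    by (intro runs_Cond runs_NAssign runs_Skip)
      (use that x hit[OF that] miss[OF that] in \<open>auto simp: nwrite_def\<close>)
  then have "runs n D (For ''i'' (scalar ''k'') ?c) (nwrite x 0 (nval e s) s)
      (7 + ncost (scalar ''k'') + k * (10 + ncost (scalar ''k'') + (1 + bcost b + 4))) (I k)"
    using init bound by (intro runs_For) auto
  then have "runs n D (scan x e b) s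
      ((2 + ncost e) + (7 + ncost (scalar ''k'') + k * (10 + ncost (scalar ''k'') + (1 + bcost b + 4)))) (I k)"
    unfolding scan_def using runs_Seq_NAssign[where i = "N 0" and e = e] by fastforce
  moreover have "k * (17 + bcost b) \<le> n * (17 + bcost b)"
    using k by simp
  ultimately show ?thesis
    by (elim runs_weaken) simp_all
qed

definition kept_test :: bexp where
  "kept_test = NEq (NCell ''out'' (scalar ''i'')) (N 0)"

text \<open>A strict improvement of \<open>\<rho> k i - \<rho> r i\<close> over its value at the
  current \<open>y\<close>, with the terms rearranged into sums.\<close>

definition closer_test :: bexp where
  "closer_test =
     RLess (RPlus (Dist (scalar ''k'') (scalar ''i'')) (Dist (scalar ''r'') (scalar ''y'')))
       (RPlus (Dist (scalar ''k'') (scalar ''y'')) (Dist (scalar ''r'') (scalar ''i'')))"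

text \<open>The language has no \<open>max\<close>: \<open>a = max b c\<close> is expressed as
  \<open>a\<close> being below neither \<open>b\<close> nor \<open>c\<close>, and not above
  both.\<close>

definition attaches_test :: bexp where
  "attaches_test =
     (let a = RPlus (Dist (scalar ''k'') (scalar ''i'')) (Dist (scalar ''r'') (scalar ''y''));
          b = RPlus (Dist (scalar ''r'') (scalar ''i'')) (Dist (scalar ''k'') (scalar ''y''));
          c = RPlus (Dist (scalar ''k'') (scalar ''r'')) (Dist (scalar ''y'') (scalar ''i''))
      in BAnd (BAnd (BNot (RLess a b)) (BNot (RLess a c))) (BNot (BAnd (RLess b a) (RLess c a))))"

definition choose_root :: com where
  "choose_root = scan ''r'' (scalar ''k'') kept_test"

text \<open>The default \<open>r\<close> makes \<open>y\<close> a kept point before any improvement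
  is found.\<close>

definition choose_neighbour :: com where
  "choose_neighbour = scan ''y'' (scalar ''r'') (BAnd kept_test closer_test)"

definition find_conflict :: com where
  "find_conflict = scan ''z'' (scalar ''k'') (BAnd kept_test (BNot attaches_test))"

definition remove_conflict :: com where
  "remove_conflict = Cond (NLess (scalar ''z'') (scalar ''k''))
     (Seq (NAssign ''out'' (scalar ''k'') (N 1))
     (Seq (NAssign ''out'' (scalar ''r'') (N 1))
     (Seq (NAssign ''out'' (scalar ''y'') (N 1))
       (NAssign ''out'' (scalar ''z'') (N 1)))))
     Skip"

definition insert_point :: com where
  "insert_point = Seq choose_root (Seq choose_neighbour (Seq find_conflict remove_conflict))"

definition greedy_outliers :: com where
  "greedy_outliers = For ''k'' (scalar ''n'') insert_point"

section \<open>Invariants of the scans\<close>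

text \<open>\<open>f\<close> is a snapshot of \<open>out\<close>, which stays fixed until the scans
  of one insertion are over.\<close>

definition at_point :: "nat \<Rightarrow> (nat \<Rightarrow> nat) \<Rightarrow> nat \<Rightarrow> state \<Rightarrow> bool" where
  "at_point n f k s \<longleftrightarrow> nmem s ''n'' 0 = n \<and> nmem s ''k'' 0 = k \<and> nmem s ''out'' = f"

definition kept :: "(nat \<Rightarrow> nat) \<Rightarrow> nat \<Rightarrow> nat set" where
  "kept f k = {i. i < k \<and> f i = 0}"

definition removed :: "(nat \<Rightarrow> nat) \<Rightarrow> nat set" where
  "removed f = {i. f i \<noteq> 0}"

text \<open>If no point has been kept, \<open>r\<close> and \<open>y\<close> are junk. The scalar \<open>z\<close> keeps its initial value \<open>k\<close>
  in the absence of a conflict.\<close>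

definition root_chosen :: "nat \<Rightarrow> (nat \<Rightarrow> nat) \<Rightarrow> nat \<Rightarrow> nat \<Rightarrow> state \<Rightarrow> bool" where
  "root_chosen n f k j s \<longleftrightarrow> at_point n f k s \<and> (kept f j \<noteq> {} \<longrightarrow> nmem s ''r'' 0 \<in> kept f k)"

text \<open>Minimality is claimed only over the scanned part \<open>kept f j\<close>, but
  \<open>y\<close> lies in \<open>kept f k\<close>, since its initial value \<open>r\<close> may not
  have been scanned yet.\<close>

definition neighbour_chosen ::
    "nat \<Rightarrow> (nat \<Rightarrow> nat \<Rightarrow> real) \<Rightarrow> (nat \<Rightarrow> nat) \<Rightarrow> nat \<Rightarrow> nat \<Rightarrow> state \<Rightarrow> bool" where
  "neighbour_chosen n \<rho> f k j s \<longleftrightarrow> root_chosen n f k k s \<and>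
     (kept f k \<noteq> {} \<longrightarrow> nmem s ''y'' 0 \<in> kept f k) \<and>
     (\<forall>z\<in>kept f j. \<rho> k (nmem s ''y'' 0) + \<rho> (nmem s ''r'' 0) z
        \<le> \<rho> k z + \<rho> (nmem s ''r'' 0) (nmem s ''y'' 0))"

definition conflict_found ::
    "nat \<Rightarrow> (nat \<Rightarrow> nat \<Rightarrow> real) \<Rightarrow> (nat \<Rightarrow> nat) \<Rightarrow> nat \<Rightarrow> nat \<Rightarrow> state \<Rightarrow> bool" where
  "conflict_found n \<rho> f k j s \<longleftrightarrow> neighbour_chosen n \<rho> f k k s \<and>
     (if nmem s ''z'' 0 < k
      then nmem s ''z'' 0 \<in> kept f k \<and>
        \<not> attaches \<rho> k (nmem s ''r'' 0) (nmem s ''y'' 0) (nmem s ''z'' 0)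
      else \<forall>z\<in>kept f j. attaches \<rho> k (nmem s ''r'' 0) (nmem s ''y'' 0) z)"

lemma kept_0 [simp]: "kept f 0 = {}"
  by (simp add: kept_def)

lemma kept_Suc: "kept f (Suc j) = (if f j = 0 then insert j (kept f j) else kept f j)"
  by (auto simp: kept_def less_Suc_eq)

lemma mem_kept: "i \<in> kept f k \<longleftrightarrow> i < k \<and> f i = 0"
  by (simp add: kept_def)

section \<open>Correctness and cost of one insertion\<close>

lemma runs_choose_root:
  assumes "at_point n f k s" "k \<le> n"
  shows "runs n D choose_root s (13 + n * 22) (root_chosen n f k k)"
proof (rule runs_weaken)
  show "runs n D choose_root s (11 + ncost (scalar ''k'') + n * (17 + bcost kept_test))
      (root_chosen n f k k)"
    unfolding choose_root_def using assms
    by (intro runs_scan[where I = "root_chosen n f k"])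
      (auto simp: root_chosen_def at_point_def nwrite_def kept_Suc mem_kept kept_test_def)
qed (auto simp: kept_test_def)

lemma runs_choose_neighbour:
  assumes "root_chosen n f k k s" "k < n"
  shows "runs n D choose_neighbour s (13 + n * 46) (neighbour_chosen n D f k k)"
proof (rule runs_weaken)
  \<comment> \<open>\<open>Dist\<close> reads 0 outside the matrix. A kept \<open>j\<close>
    guarantees that \<open>r\<close> and \<open>y\<close> are genuine points and hence in
    range.\<close>
  have closer_test: "bval n D closer_test s \<longleftrightarrow>
      D k j + D (nmem s ''r'' 0) (nmem s ''y'' 0) < D k (nmem s ''y'' 0) + D (nmem s ''r'' 0) j"
    if "neighbour_chosen n D f k j s" "nmem s ''i'' 0 = j" "j \<in> kept f k" for j s
  proof -
    have "kept f k \<noteq> {}"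
      using that(3) by blast
    then show ?thesis
      using that assms(2)
      by (simp add: closer_test_def neighbour_chosen_def root_chosen_def at_point_def mem_kept)
  qed
  show "runs n D choose_neighbour s
      (11 + ncost (scalar ''r'') + n * (17 + bcost (BAnd kept_test closer_test)))
      (neighbour_chosen n D f k k)"
    unfolding choose_neighbour_def
  proof (rule runs_scan[where I = "neighbour_chosen n D f k"])
    show "neighbour_chosen n D f k 0 (nwrite ''i'' 0 0 (nwrite ''y'' 0 (nval (scalar ''r'') s) s))"
      using assms by (auto simp: neighbour_chosen_def root_chosen_def at_point_def nwrite_def)
  next
    fix j s
    assume *: "j < k" "neighbour_chosen n D f k j s" "nmem s ''i'' 0 = j"
      "bval n D (BAnd kept_test closer_test) s"
    then have "j \<in> kept f k"
      by (auto simp: neighbour_chosen_def root_chosen_def at_point_def mem_kept kept_test_def)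
    \<comment> \<open>The new \<open>y\<close> improves on the old one, so the inequalities for
      earlier points persist by transitivity.\<close>
    then show "neighbour_chosen n D f k (Suc j) (nwrite ''i'' 0 (Suc j) (nwrite ''y'' 0 j s))"
      using * closer_test[OF *(2,3)]
      by (fastforce simp: neighbour_chosen_def root_chosen_def at_point_def nwrite_def kept_Suc)
  next
    fix j s
    assume *: "j < k" "neighbour_chosen n D f k j s" "nmem s ''i'' 0 = j"
      "\<not> bval n D (BAnd kept_test closer_test) s"
    then show "neighbour_chosen n D f k (Suc j) (nwrite ''i'' 0 (Suc j) s)"
      using closer_test[OF *(2,3)]
      by (auto simp: neighbour_chosen_def root_chosen_def at_point_def nwrite_def kept_Suc
          mem_kept kept_test_def)
  qed (use assms in \<open>auto simp: neighbour_chosen_def root_chosen_def at_point_def\<close>)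
qed (auto simp: kept_test_def closer_test_def)

lemma bval_attaches_test:
  assumes "nmem s ''k'' 0 < n" "nmem s ''r'' 0 < n" "nmem s ''y'' 0 < n" "nmem s ''i'' 0 < n"
  shows "bval n D attaches_test s \<longleftrightarrow>
    attaches D (nmem s ''k'' 0) (nmem s ''r'' 0) (nmem s ''y'' 0) (nmem s ''i'' 0)"
  using assms by (auto simp: attaches_test_def attaches_def Let_def max_def)

lemma runs_find_conflict:
  assumes "neighbour_chosen n D f k k s" "k < n"
  shows "runs n D find_conflict s (13 + n * 122) (conflict_found n D f k k)"
proof (rule runs_weaken)
  have attaches_test: "bval n D attaches_test s \<longleftrightarrow> attaches D k (nmem s ''r'' 0) (nmem s ''y'' 0) j"
    if "conflict_found n D f k j s" "nmem s ''i'' 0 = j" "j \<in> kept f k" for j s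
  proof -
    have "kept f k \<noteq> {}"
      using that(3) by blast
    then show ?thesis
      using that assms(2) bval_attaches_test[of s n D]
      by (simp add: conflict_found_def neighbour_chosen_def root_chosen_def at_point_def mem_kept)
  qed
  show "runs n D find_conflict s
      (11 + ncost (scalar ''k'') + n * (17 + bcost (BAnd kept_test (BNot attaches_test))))
      (conflict_found n D f k k)"
    unfolding find_conflict_def
  proof (rule runs_scan[where I = "conflict_found n D f k"])
    \<comment> \<open>The default \<open>z = k\<close> selects the universal branch, which is
      vacuous over \<open>kept f 0\<close>.\<close>
    show "conflict_found n D f k 0 (nwrite ''i'' 0 0 (nwrite ''z'' 0 (nval (scalar ''k'') s) s))"
      using assms
      by (auto simp: conflict_found_def neighbour_chosen_def root_chosen_def at_point_def nwrite_def)
  next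
    fix j s
    assume *: "j < k" "conflict_found n D f k j s" "nmem s ''i'' 0 = j"
      "bval n D (BAnd kept_test (BNot attaches_test)) s"
    then have "j \<in> kept f k"
      by (auto simp: conflict_found_def neighbour_chosen_def root_chosen_def at_point_def mem_kept
          kept_test_def)
    then show "conflict_found n D f k (Suc j) (nwrite ''i'' 0 (Suc j) (nwrite ''z'' 0 j s))"
      using * attaches_test[OF *(2,3)]
      by (auto simp: conflict_found_def neighbour_chosen_def root_chosen_def at_point_def nwrite_def)
  next
    fix j s
    assume *: "j < k" "conflict_found n D f k j s" "nmem s ''i'' 0 = j"
      "\<not> bval n D (BAnd kept_test (BNot attaches_test)) s"
    then show "conflict_found n D f k (Suc j) (nwrite ''i'' 0 (Suc j) s)"
      using attaches_test[OF *(2,3)]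
      by (auto simp: conflict_found_def neighbour_chosen_def root_chosen_def at_point_def nwrite_def
          kept_Suc mem_kept kept_test_def)
  qed (use assms in \<open>auto simp: conflict_found_def neighbour_chosen_def root_chosen_def at_point_def\<close>)
qed (auto simp: kept_test_def attaches_test_def Let_def)

lemma runs_remove_conflict:
  assumes "Metric_space {..<n} D" "k < n" "partial_outliers n D k (removed f)"
    and "conflict_found n D f k k s"
  shows "runs n D remove_conflict s 30 (\<lambda>s'. nmem s' ''n'' 0 = n \<and> nmem s' ''k'' 0 = k \<and>
    partial_outliers n D (Suc k) (removed (nmem s' ''out'')))"
proof -
  let ?r = "nmem s ''r'' 0" and ?y = "nmem s ''y'' 0" and ?z = "nmem s ''z'' 0"
  let ?f = "f(k := 1, ?r := 1, ?y := 1, ?z := 1)"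
  have kept: "kept f k = {..<k} - removed f"
    by (auto simp: kept_def removed_def)
  have at: "at_point n f k s"
    and inv: "kept f k \<noteq> {} \<Longrightarrow> ?r \<in> kept f k \<and> ?y \<in> kept f k"
      "\<And>z. z \<in> kept f k \<Longrightarrow> D k ?y + D ?r z \<le> D k z + D ?r ?y"
    using assms(4) by (auto simp: conflict_found_def neighbour_chosen_def root_chosen_def)
  show ?thesis
  proof (cases "?z < k")
    case True
    then have z: "?z \<in> kept f k" "\<not> attaches D k ?r ?y ?z"
      using assms(4) by (auto simp: conflict_found_def)
    have "removed ?f = removed f \<union> {k, ?r, ?y, ?z}"
      by (auto simp: removed_def)
    \<comment> \<open>The conflict \<open>z\<close> is itself kept, so \<open>kept f k\<close> is
      nonempty and \<open>r\<close>, \<open>y\<close> are not junk.\<close>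
    then have R: "partial_outliers n D (Suc k) (removed ?f)"
      using partial_outliers_remove[OF assms(2,3) kept _ _ z(1) inv(2)[OF z(1)] z(2)] inv(1) z(1)
      by fastforce
    show ?thesis
      unfolding remove_conflict_def
      by (rule runs_weaken[OF runs_Cond[OF runs_Seq_NAssign[OF runs_Seq_NAssign[OF
              runs_Seq_NAssign[OF runs_NAssign[OF _ order.refl]]]]]])
        (use True at R in \<open>simp_all add: at_point_def nwrite_def\<close>)
  next
    case False
    then have "\<And>z. z \<in> kept f k \<Longrightarrow> attaches D k ?r ?y z"
      using assms(4) by (auto simp: conflict_found_def)
    then have "partial_outliers n D (Suc k) (removed f)"
      using partial_outliers_keep[OF assms(1-3) kept] inv(1) by blast
    moreover have "exec n D remove_conflict s (1 + bcost (NLess (scalar ''z'') (scalar ''k'')) + 1) s"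
      unfolding remove_conflict_def using False at
      by (intro exec_CondFalse exec_Skip) (auto simp: at_point_def)
    ultimately show ?thesis
      unfolding runs_def using at by (intro exI conjI) (auto simp: at_point_def)
  qed
qed

lemma runs_insert_point:
  assumes "Metric_space {..<n} D" "k < n" "partial_outliers n D k (removed (nmem s ''out''))"
    and "nmem s ''n'' 0 = n" "nmem s ''k'' 0 = k"
  shows "runs n D insert_point s (69 + n * 190) (\<lambda>s'. nmem s' ''n'' 0 = n \<and> nmem s' ''k'' 0 = k \<and>
    partial_outliers n D (Suc k) (removed (nmem s' ''out'')))"
proof (rule runs_weaken)
  show "runs n D insert_point s ((13 + n * 22) + ((13 + n * 46) + ((13 + n * 122) + 30)))
    (\<lambda>s'. nmem s' ''n'' 0 = n \<and> nmem s' ''k'' 0 = k \<and>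
      partial_outliers n D (Suc k) (removed (nmem s' ''out'')))"
    unfolding insert_point_def
    by (rule runs_Seq[OF runs_choose_root runs_Seq[OF runs_choose_neighbour
            runs_Seq[OF runs_find_conflict runs_remove_conflict]]])
      (use assms in \<open>auto simp: at_point_def\<close>)
qed auto

section \<open>The whole run and its quadratic time bound\<close>

lemma runs_greedy_outliers:
  assumes "Metric_space {..<n} D"
  shows "runs n D greedy_outliers (init_state n) (9 + n * (81 + n * 190))
    (\<lambda>s. partial_outliers n D n (outcome n s))"
proof (rule runs_weaken)
  let ?I = "\<lambda>k (s :: state). nmem s ''n'' 0 = n \<and> partial_outliers n D k (removed (nmem s ''out''))"
  show "runs n D greedy_outliers (init_state n)
      (7 + ncost (scalar ''n'') + n * (10 + ncost (scalar ''n'') + (69 + n * 190))) (?I n)"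
    unfolding greedy_outliers_def
  proof (rule runs_For[where I = ?I])
    show "?I 0 (nwrite ''k'' 0 0 (init_state n))"
      using partial_outliers_0[OF assms] by (simp add: init_state_def nwrite_def removed_def)
  next
    fix k s assume "k < n" "?I k s" "nmem s ''k'' 0 = k"
    then show "runs n D insert_point s (69 + n * 190)
        (\<lambda>s'. nmem s' ''k'' 0 = k \<and> ?I (Suc k) (nwrite ''k'' 0 (Suc k) s'))"
      by (intro runs_weaken[OF runs_insert_point[OF assms]]) (auto simp: nwrite_def)
  qed auto
next
  fix s :: state assume I: "nmem s ''n'' 0 = n \<and> partial_outliers n D n (removed (nmem s ''out''))"
  \<comment> \<open>Restricting the output to indices below \<open>n\<close> loses nothing, because
    the invariant confines the removed points to \<open>{..<n}\<close>.\<close>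
  then have "outcome n s = removed (nmem s ''out'')"
    by (auto simp: outcome_def removed_def partial_outliers_def)
  then show "partial_outliers n D n (outcome n s)"
    using I by simp
qed auto

theorem theorem12:
  "\<exists>(P :: com) (T :: nat \<Rightarrow> nat).
     (\<lambda>n. real (T n)) \<in> O(\<lambda>n. real n ^ 2) \<and>
     (\<forall>(n :: nat) (\<rho> :: nat \<Rightarrow> nat \<Rightarrow> real). Metric_space {..<n} \<rho> \<longrightarrow>
        (\<exists>t s. exec n \<rho> P (init_state n) t s \<and> t \<le> T n \<and>
           outlier_set {..<n} \<rho> (outcome n s) \<and>
           (\<forall>Q. min_outlier_set {..<n} \<rho> Q \<longrightarrow> card (outcome n s) \<le> 4 * card Q)))"
proof (rule exI[of _ greedy_outliers], rule exI[of _ "\<lambda>n. 9 + n * (81 + n * 190)"],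
    intro conjI allI impI)
  let ?T = "\<lambda>n :: nat. 9 + n * (81 + n * 190)"
  \<comment> \<open>280 is 9 + 81 + 190, all lower powers of \<open>n\<close> being at most
    \<open>n ^ 2\<close> once \<open>1 \<le> n\<close>.\<close>
  have "real (?T n) \<le> 280 * real n ^ 2" if "1 \<le> n" for n
  proof -
    have "1 \<le> real n"
      using that by simp
    then have "real n \<le> real n ^ 2"
      by (intro self_le_power) simp_all
    have "real (?T n) = 9 + 81 * real n + 190 * real n ^ 2"
      by (simp add: algebra_simps power2_eq_square)
    also have "\<dots> \<le> 280 * real n ^ 2"
      using \<open>1 \<le> real n\<close> \<open>real n \<le> real n ^ 2\<close>
      by linarith
    finally show ?thesis .
  qed
  then show "(\<lambda>n. real (?T n)) \<in> O(\<lambda>n. real n ^ 2)"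
    by (intro bigoI[where c = 280] eventually_mono[OF eventually_ge_at_top[of 1]]) simp
  fix n :: nat and \<rho> :: "nat \<Rightarrow> nat \<Rightarrow> real"
  assume "Metric_space {..<n} \<rho>"
  then obtain t s where "exec n \<rho> greedy_outliers (init_state n) t s" "t \<le> ?T n"
    and R: "partial_outliers n \<rho> n (outcome n s)"
    using runs_greedy_outliers unfolding runs_def by blast
  then show "\<exists>t s. exec n \<rho> greedy_outliers (init_state n) t s \<and> t \<le> ?T n \<and>
      outlier_set {..<n} \<rho> (outcome n s) \<and>
      (\<forall>Q. min_outlier_set {..<n} \<rho> Q \<longrightarrow> card (outcome n s) \<le> 4 * card Q)"
    using partial_outliers_outlier_set[OF R] partial_outliers_card_le[OF R]
    unfolding min_outlier_set_def is_arg_min_def by blast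
qed

end
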